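(* Let $A$ be a finitely generated semisimple MV-algebra whose maximal ideals of finite rank form a dense subset of the maximal spectral space $\mu(A)$. Then $A$ is hopfian.
   Context: An MV-algebra is an abelian monoid $(A,0,\oplus)$ with a unary operation $\neg$ satisfying $\neg\neg x=x$, $x\oplus\neg 0=\neg 0$ and $\neg(\neg x\oplus y)\oplus y=\neg(\neg y\oplus x)\oplus x$. All MV-algebras are assumed nontrivial. An ideal of $A$ is the kernel $h^{-1}(0)$ of a homomorphism $h$ on $A$; ideals are assumed proper. $\mu(A)$ is the set of maximal ideals of $A$ with the hull-kernel topology: a basis of closed sets is given by the sets $\{\mathfrak m\in\mu(A)\mid a\in\mathfrak m\}$, $a\in A$. $A$ is semisimple if the intersection of its maximal ideals is $\{0\}$. A maximal ideal $\mathfrak m$ has finite rank if the quotient $A/\mathfrak m$ is finite. $A$ is hopfian if every homomorphism of $A$ onto $A$ is an automorphism. *)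

theory Defs
  imports "HOL-Analysis.Function_Topology" "HOL-Algebra.Group"
begin

section \<open>MV-algebras\<close>

record 'a mv_algebra = "'a partial_object" +
  zero :: 'a (\<open>\<zero>\<index>\<close>)
  add :: "'a \<Rightarrow> 'a \<Rightarrow> 'a" (infixl \<open>\<oplus>\<index>\<close> 65)
  neg :: "'a \<Rightarrow> 'a" (\<open>\<sim>\<index> _\<close> [81] 80)

text \<open>The last assumption is the convention that all MV-algebras are nontrivial.\<close>

locale mv_algebra =
  fixes A :: "('a, 'b) mv_algebra_scheme" (structure)
  assumes add_comm_monoid:
      "comm_monoid \<lparr>carrier = carrier A, mult = add A, one = zero A\<rparr>"
    and neg_closed: "x \<in> carrier A \<Longrightarrow> \<sim> x \<in> carrier A"
    and neg_neg: "x \<in> carrier A \<Longrightarrow> \<sim> (\<sim> x) = x"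
    and add_neg_zero: "x \<in> carrier A \<Longrightarrow> x \<oplus> \<sim> \<zero> = \<sim> \<zero>"
    and lukasiewicz: "x \<in> carrier A \<Longrightarrow> y \<in> carrier A \<Longrightarrow>
      \<sim> (\<sim> x \<oplus> y) \<oplus> y = \<sim> (\<sim> y \<oplus> x) \<oplus> x"
    and nontrivial: "carrier A \<noteq> {\<zero>}"

definition mv_hom ::
    "('a, 'c) mv_algebra_scheme \<Rightarrow> ('b, 'd) mv_algebra_scheme \<Rightarrow> ('a \<Rightarrow> 'b) set" where
  "mv_hom A B = {h. h \<in> carrier A \<rightarrow> carrier B \<and> h \<zero>\<^bsub>A\<^esub> = \<zero>\<^bsub>B\<^esub> \<and>
     (\<forall>x\<in>carrier A. \<forall>y\<in>carrier A. h (x \<oplus>\<^bsub>A\<^esub> y) = h x \<oplus>\<^bsub>B\<^esub> h y) \<and>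
     (\<forall>x\<in>carrier A. h (\<sim>\<^bsub>A\<^esub> x) = \<sim>\<^bsub>B\<^esub> h x)}"

definition mv_kernel ::
    "('a, 'c) mv_algebra_scheme \<Rightarrow> ('b, 'd) mv_algebra_scheme \<Rightarrow> ('a \<Rightarrow> 'b) \<Rightarrow> 'a set" where
  "mv_kernel A B h = {x \<in> carrier A. h x = \<zero>\<^bsub>B\<^esub>}"

definition mv_automorphism :: "('a, 'c) mv_algebra_scheme \<Rightarrow> ('a \<Rightarrow> 'a) \<Rightarrow> bool" where
  "mv_automorphism A h \<longleftrightarrow> h \<in> mv_hom A A \<and> bij_betw h (carrier A) (carrier A)"

definition mv_hopfian :: "('a, 'c) mv_algebra_scheme \<Rightarrow> bool" where
  "mv_hopfian A \<longleftrightarrow>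
     (\<forall>h\<in>mv_hom A A. h ` carrier A = carrier A \<longrightarrow> mv_automorphism A h)"

inductive_set mv_generate :: "('a, 'c) mv_algebra_scheme \<Rightarrow> 'a set \<Rightarrow> 'a set"
  for A and S where
    zero: "\<zero>\<^bsub>A\<^esub> \<in> mv_generate A S"
  | incl: "x \<in> S \<Longrightarrow> x \<in> mv_generate A S"
  | add: "x \<in> mv_generate A S \<Longrightarrow> y \<in> mv_generate A S \<Longrightarrow> x \<oplus>\<^bsub>A\<^esub> y \<in> mv_generate A S"
  | neg: "x \<in> mv_generate A S \<Longrightarrow> \<sim>\<^bsub>A\<^esub> x \<in> mv_generate A S"

definition mv_finitely_generated :: "('a, 'c) mv_algebra_scheme \<Rightarrow> bool" where
  "mv_finitely_generated A \<longleftrightarrow>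
     (\<exists>S. finite S \<and> S \<subseteq> carrier A \<and> mv_generate A S = carrier A)"


section \<open>Ideals and quotients\<close>

text \<open>
  The codomain is restricted to the type \<open>'a set\<close> because a definition cannot quantify over
  types. This loses no generality: by \<open>mv_ideal_kernel\<close> below, the kernel of a homomorphism into
  an MV-algebra over any type is an ideal in this sense. Ideals are automatically proper
  (\<open>mv_ideal_proper\<close>), as the codomain is nontrivial.
\<close>

definition mv_ideal :: "('a, 'c) mv_algebra_scheme \<Rightarrow> 'a set \<Rightarrow> bool" where
  "mv_ideal A I \<longleftrightarrow>
     (\<exists>(B :: 'a set mv_algebra) h. mv_algebra B \<and> h \<in> mv_hom A B \<and> I = mv_kernel A B h)"

text \<open>
  \<open>mv_diff A x y\<close> is the truncated difference of \<open>x\<close> and \<open>y\<close>, and the congruence of an ideal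
  identifies \<open>x\<close> and \<open>y\<close> when their distance lies in the ideal. For the kernel of a homomorphism
  \<open>h\<close> this is the relation \<open>h x = h y\<close>; see \<open>mv_cong_kernel_iff\<close>.
\<close>

definition mv_diff :: "('a, 'c) mv_algebra_scheme \<Rightarrow> 'a \<Rightarrow> 'a \<Rightarrow> 'a" where
  "mv_diff A x y = \<sim>\<^bsub>A\<^esub> (\<sim>\<^bsub>A\<^esub> x \<oplus>\<^bsub>A\<^esub> y)"

definition mv_cong :: "('a, 'c) mv_algebra_scheme \<Rightarrow> 'a set \<Rightarrow> ('a \<times> 'a) set" where
  "mv_cong A I = {(x, y). x \<in> carrier A \<and> y \<in> carrier A \<and>
     mv_diff A x y \<oplus>\<^bsub>A\<^esub> mv_diff A y x \<in> I}"

definition mv_quotient :: "('a, 'c) mv_algebra_scheme \<Rightarrow> 'a set \<Rightarrow> 'a set mv_algebra" where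
  "mv_quotient A I = \<lparr>
     carrier = carrier A // mv_cong A I,
     zero = mv_cong A I `` {\<zero>\<^bsub>A\<^esub>},
     add = (\<lambda>X Y. \<Union>x\<in>X. \<Union>y\<in>Y. mv_cong A I `` {x \<oplus>\<^bsub>A\<^esub> y}),
     neg = (\<lambda>X. \<Union>x\<in>X. mv_cong A I `` {\<sim>\<^bsub>A\<^esub> x})\<rparr>"


section \<open>The maximal spectral space\<close>

definition mv_maximal_ideal :: "('a, 'c) mv_algebra_scheme \<Rightarrow> 'a set \<Rightarrow> bool" where
  "mv_maximal_ideal A M \<longleftrightarrow> mv_ideal A M \<and> (\<forall>I. mv_ideal A I \<and> M \<subseteq> I \<longrightarrow> I = M)"

definition mv_max_spec :: "('a, 'c) mv_algebra_scheme \<Rightarrow> 'a set set" where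
  "mv_max_spec A = {M. mv_maximal_ideal A M}"

text \<open>
  The hull-kernel topology: the sets of all maximal ideals containing a given \<open>a\<close> form a basis of
  closed sets, i.e.\ their complements form a basis of open sets. So the topology is the one
  generated by these complements.
\<close>

definition mv_max_spec_topology :: "('a, 'c) mv_algebra_scheme \<Rightarrow> 'a set topology" where
  "mv_max_spec_topology A = topology_generated_by
     {mv_max_spec A - {M \<in> mv_max_spec A. a \<in> M} | a. a \<in> carrier A}"

definition mv_semisimple :: "('a, 'c) mv_algebra_scheme \<Rightarrow> bool" where
  "mv_semisimple A \<longleftrightarrow> \<Inter> (mv_max_spec A) = {\<zero>\<^bsub>A\<^esub>}"

definition mv_finite_rank :: "('a, 'c) mv_algebra_scheme \<Rightarrow> 'a set \<Rightarrow> bool" where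
  "mv_finite_rank A M \<longleftrightarrow> finite (carrier (mv_quotient A M))"


section \<open>Adequacy of the definitions\<close>

context mv_algebra
begin

sublocale add: comm_monoid "\<lparr>carrier = carrier A, mult = add A, one = zero A\<rparr>"
  rewrites "carrier \<lparr>carrier = carrier A, mult = add A, one = zero A\<rparr> = carrier A"
    and "mult \<lparr>carrier = carrier A, mult = add A, one = zero A\<rparr> = add A"
    and "one \<lparr>carrier = carrier A, mult = add A, one = zero A\<rparr> = zero A"
  by (rule add_comm_monoid) auto

lemma neg_add_self: "x \<in> carrier A \<Longrightarrow> \<sim> x \<oplus> x = \<sim> \<zero>"
  using lukasiewicz[of x "\<sim> \<zero>"]
  by (simp add: neg_closed neg_neg add_neg_zero add.l_one)

lemma zero_if_add_zero:
  assumes "x \<in> carrier A" "y \<in> carrier A" "x \<oplus> y = \<zero>"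
  shows "x = \<zero>"
proof -
  have "\<sim> x = \<sim> x \<oplus> (x \<oplus> y)"
    using assms by (simp add: neg_closed)
  also have "\<dots> = (\<sim> x \<oplus> x) \<oplus> y"
    using assms by (simp add: neg_closed add.m_assoc)
  also have "\<dots> = \<sim> \<zero>"
    using assms by (simp add: neg_add_self neg_closed add_neg_zero add.m_comm[of "\<sim> \<zero>"])
  finally show ?thesis
    using assms by (metis neg_neg add.one_closed)
qed

lemma diff_closed: "x \<in> carrier A \<Longrightarrow> y \<in> carrier A \<Longrightarrow> mv_diff A x y \<in> carrier A"
  by (simp add: mv_diff_def neg_closed)

lemma dist_zero_iff:
  assumes "x \<in> carrier A" "y \<in> carrier A"
  shows "mv_diff A x y \<oplus> mv_diff A y x = \<zero> \<longleftrightarrow> x = y"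
proof
  assume *: "mv_diff A x y \<oplus> mv_diff A y x = \<zero>"
  then have 1: "mv_diff A x y = \<zero>"
    using assms by (meson diff_closed zero_if_add_zero)
  have 2: "mv_diff A y x = \<zero>"
    using * assms by (metis add.m_comm diff_closed zero_if_add_zero)
  show "x = y"
    using lukasiewicz[OF assms] 1 2 assms by (simp add: mv_diff_def)
next
  assume "x = y"
  then show "mv_diff A x y \<oplus> mv_diff A y x = \<zero>"
    using assms by (simp add: mv_diff_def neg_add_self neg_neg)
qed

lemma zero_neq_neg_zero: "\<zero> \<noteq> \<sim> \<zero>"
proof
  assume "\<zero> = \<sim> \<zero>"
  then have "x = \<zero>" if "x \<in> carrier A" for x
    using add_neg_zero[OF that] that by simp
  then show False
    using nontrivial by auto
qed

end

lemma mv_cong_kernel_iff: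
  assumes "mv_algebra A" "mv_algebra B" "h \<in> mv_hom A B"
  shows "(x, y) \<in> mv_cong A (mv_kernel A B h) \<longleftrightarrow>
    x \<in> carrier A \<and> y \<in> carrier A \<and> h x = h y"
proof -
  interpret A: mv_algebra A by fact
  interpret B: mv_algebra B by fact
  have "h (mv_diff A x y) = mv_diff B (h x) (h y)" if "x \<in> carrier A" "y \<in> carrier A" for x y
    using assms(3) that by (simp add: mv_hom_def mv_diff_def A.neg_closed)
  moreover have "h x \<in> carrier B" if "x \<in> carrier A" for x
    using assms(3) that by (auto simp: mv_hom_def)
  ultimately show ?thesis
    using assms(3) B.dist_zero_iff[of "h x" "h y"]
    by (auto simp: mv_cong_def mv_kernel_def mv_hom_def A.diff_closed)
qed

lemma mv_quotient_kernel:
  assumes A: "mv_algebra A" and B: "mv_algebra B" and h: "h \<in> mv_hom A B"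
  defines "K \<equiv> mv_kernel A B h"
  shows "mv_algebra (mv_quotient A K)"
    and "(\<lambda>x. mv_cong A K `` {x}) \<in> mv_hom A (mv_quotient A K)"
    and "mv_kernel A (mv_quotient A K) (\<lambda>x. mv_cong A K `` {x}) = K"
proof -
  interpret A: mv_algebra A by fact
  interpret B: mv_algebra B by fact
  define c where "c x = mv_cong A K `` {x}" for x
  have c: "c x = {y \<in> carrier A. h y = h x}" if "x \<in> carrier A" for x
    using that mv_cong_kernel_iff[OF A B h] by (auto simp: c_def K_def)
  have h_closed: "h x \<in> carrier B" if "x \<in> carrier A" for x
    using h that by (auto simp: mv_hom_def)
  have h_zero: "h \<zero>\<^bsub>A\<^esub> = \<zero>\<^bsub>B\<^esub>"
    and h_add: "\<And>x y. x \<in> carrier A \<Longrightarrow> y \<in> carrier A \<Longrightarrow> h (x \<oplus>\<^bsub>A\<^esub> y) = h x \<oplus>\<^bsub>B\<^esub> h y"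
    and h_neg: "\<And>x. x \<in> carrier A \<Longrightarrow> h (\<sim>\<^bsub>A\<^esub> x) = \<sim>\<^bsub>B\<^esub> h x"
    using h by (auto simp: mv_hom_def)
  have c_eq: "c x = c y \<longleftrightarrow> h x = h y" if "x \<in> carrier A" "y \<in> carrier A" for x y
    using that by (auto simp: c)
  have carr: "carrier (mv_quotient A K) = c ` carrier A"
    by (auto simp: mv_quotient_def quotient_def c_def)
  have zero: "\<zero>\<^bsub>mv_quotient A K\<^esub> = c \<zero>\<^bsub>A\<^esub>"
    by (simp add: mv_quotient_def c_def)
  have add: "c x \<oplus>\<^bsub>mv_quotient A K\<^esub> c y = c (x \<oplus>\<^bsub>A\<^esub> y)"
    if "x \<in> carrier A" "y \<in> carrier A" for x y
  proof -
    have "c (x' \<oplus>\<^bsub>A\<^esub> y') = c (x \<oplus>\<^bsub>A\<^esub> y)" if "x' \<in> c x" "y' \<in> c y" for x' y'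
      using that \<open>x \<in> carrier A\<close> \<open>y \<in> carrier A\<close> by (auto simp: c h_add)
    then have "(\<Union>x'\<in>c x. \<Union>y'\<in>c y. c (x' \<oplus>\<^bsub>A\<^esub> y')) =
        (\<Union>x'\<in>c x. \<Union>y'\<in>c y. c (x \<oplus>\<^bsub>A\<^esub> y))"
      by (intro SUP_cong refl)
    moreover have "c x \<noteq> {}" "c y \<noteq> {}"
      using that by (auto simp: c)
    ultimately show ?thesis
      by (simp add: mv_quotient_def c_def[symmetric])
  qed
  have neg: "\<sim>\<^bsub>mv_quotient A K\<^esub> c x = c (\<sim>\<^bsub>A\<^esub> x)" if "x \<in> carrier A" for x
  proof -
    have "c (\<sim>\<^bsub>A\<^esub> x') = c (\<sim>\<^bsub>A\<^esub> x)" if "x' \<in> c x" for x'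
      using that \<open>x \<in> carrier A\<close> by (auto simp: c h_neg A.neg_closed)
    then have "(\<Union>x'\<in>c x. c (\<sim>\<^bsub>A\<^esub> x')) = (\<Union>x'\<in>c x. c (\<sim>\<^bsub>A\<^esub> x))"
      by (intro SUP_cong refl)
    moreover have "c x \<noteq> {}"
      using that by (auto simp: c)
    ultimately show ?thesis
      by (simp add: mv_quotient_def c_def[symmetric])
  qed
  have "c (\<sim>\<^bsub>A\<^esub> \<zero>\<^bsub>A\<^esub>) \<noteq> c \<zero>\<^bsub>A\<^esub>"
    using B.zero_neq_neg_zero by (auto simp: c_eq A.neg_closed h_zero h_neg)
  then have "c ` carrier A \<noteq> {c \<zero>\<^bsub>A\<^esub>}"
    using A.neg_closed[OF A.add.one_closed] by blast
  then have nontriv: "carrier (mv_quotient A K) \<noteq> {\<zero>\<^bsub>mv_quotient A K\<^esub>}"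
    by (simp only: carr zero not_False_eq_True)
  have "comm_monoid \<lparr>carrier = carrier (mv_quotient A K),
      mult = mv_algebra.add (mv_quotient A K), one = \<zero>\<^bsub>mv_quotient A K\<^esub>\<rparr>"
    by (rule comm_monoidI) (auto simp: carr zero add A.add.m_ac)
  then show "mv_algebra (mv_quotient A K)"
  proof (rule mv_algebra.intro)
    show "\<sim>\<^bsub>mv_quotient A K\<^esub> (\<sim>\<^bsub>mv_quotient A K\<^esub> X \<oplus>\<^bsub>mv_quotient A K\<^esub> Y) \<oplus>\<^bsub>mv_quotient A K\<^esub> Y =
        \<sim>\<^bsub>mv_quotient A K\<^esub> (\<sim>\<^bsub>mv_quotient A K\<^esub> Y \<oplus>\<^bsub>mv_quotient A K\<^esub> X) \<oplus>\<^bsub>mv_quotient A K\<^esub> X"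
      if "X \<in> carrier (mv_quotient A K)" "Y \<in> carrier (mv_quotient A K)" for X Y
    proof -
      from that obtain x y where "x \<in> carrier A" "X = c x" "y \<in> carrier A" "Y = c y"
        unfolding carr by blast
      then show ?thesis
        using A.lukasiewicz[of x y] by (simp add: add neg A.neg_closed)
    qed
  qed (use nontriv in \<open>auto simp: carr zero add neg A.neg_closed A.neg_neg A.add_neg_zero\<close>)
  show "(\<lambda>x. mv_cong A K `` {x}) \<in> mv_hom A (mv_quotient A K)"
    unfolding c_def[symmetric] by (auto simp: mv_hom_def carr zero add neg)
  have "c x = c \<zero>\<^bsub>A\<^esub> \<longleftrightarrow> x \<in> K" if "x \<in> carrier A" for x
    using that by (simp add: c_eq h_zero K_def mv_kernel_def)
  moreover have "K \<subseteq> carrier A"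
    by (auto simp: K_def mv_kernel_def)
  ultimately show "mv_kernel A (mv_quotient A K) (\<lambda>x. mv_cong A K `` {x}) = K"
    unfolding c_def[symmetric] mv_kernel_def zero by blast
qed

theorem mv_ideal_kernel:
  assumes "mv_algebra A" "mv_algebra B" "h \<in> mv_hom A B"
  shows "mv_ideal A (mv_kernel A B h)"
  unfolding mv_ideal_def using mv_quotient_kernel[OF assms] by metis

lemma neg_zero_notin_mv_ideal:
  assumes "mv_algebra A" "mv_ideal A I"
  shows "\<sim>\<^bsub>A\<^esub> \<zero>\<^bsub>A\<^esub> \<notin> I"
proof -
  interpret A: mv_algebra A by fact
  from assms(2) obtain B :: "'a set mv_algebra" and h
    where B: "mv_algebra B" and h: "h \<in> mv_hom A B" and I: "I = mv_kernel A B h"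
    unfolding mv_ideal_def by blast
  interpret B: mv_algebra B by fact
  have "h (\<sim>\<^bsub>A\<^esub> \<zero>\<^bsub>A\<^esub>) = \<sim>\<^bsub>B\<^esub> \<zero>\<^bsub>B\<^esub>"
    using h by (simp add: mv_hom_def)
  then show ?thesis
    using B.zero_neq_neg_zero unfolding I mv_kernel_def by simp
qed

lemma mv_ideal_proper:
  assumes "mv_algebra A" "mv_ideal A I"
  shows "I \<subset> carrier A"
proof -
  interpret A: mv_algebra A by fact
  have "I \<subseteq> carrier A"
    using assms(2) by (auto simp: mv_ideal_def mv_kernel_def)
  then show ?thesis
    using neg_zero_notin_mv_ideal[OF assms] A.neg_closed[OF A.add.one_closed] by blast
qed

lemma topspace_mv_max_spec_topology:
  assumes "mv_algebra A"
  shows "topspace (mv_max_spec_topology A) = mv_max_spec A"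
proof -
  interpret A: mv_algebra A by fact
  have "mv_max_spec A = mv_max_spec A - {M \<in> mv_max_spec A. \<sim>\<^bsub>A\<^esub> \<zero>\<^bsub>A\<^esub> \<in> M}"
    using neg_zero_notin_mv_ideal[OF assms] by (auto simp: mv_max_spec_def mv_maximal_ideal_def)
  then show ?thesis
    unfolding mv_max_spec_topology_def topology_generated_by_topspace
    using A.neg_closed[OF A.add.one_closed] by blast
qed

end

(* Semisimplicity together with density makes A residually finite: a nonzero a is avoided by some
   maximal ideal, hence by one of finite rank. Malcev's argument then applies. For a finite
   MV-algebra B there are only finitely many homomorphisms from the finitely generated algebra A
   to B, and precomposition with a surjective endomorphism h permutes them. So every homomorphism
   from A to B factors through h and kills the kernel of h, which is therefore trivial. *)

theory Submission
  imports Defs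
begin

lemma mv_hom_eq_on_generate:
  assumes "mv_algebra A" "S \<subseteq> carrier A"
    and f: "f \<in> mv_hom A B" and g: "g \<in> mv_hom A B"
    and eq: "\<And>s. s \<in> S \<Longrightarrow> f s = g s"
    and "x \<in> mv_generate A S"
  shows "f x = g x"
proof -
  interpret mv_algebra A by fact
  from \<open>x \<in> mv_generate A S\<close> have "x \<in> carrier A \<and> f x = g x"
    by induction (use f g eq \<open>S \<subseteq> carrier A\<close> neg_closed in \<open>auto simp: mv_hom_def\<close>)
  then show ?thesis ..
qed

lemma mv_hom_compose:
  assumes "f \<in> mv_hom A B" "g \<in> mv_hom B C"
  shows "g \<circ> f \<in> mv_hom A C"
  using assms by (auto simp: mv_hom_def Pi_iff)

text \<open>Membership in \<open>mv_hom\<close> constrains a function only on the carrier, so one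
  homomorphism has many representatives. Restriction picks the one in
  \<open>extensional (carrier A)\<close>, which makes counting meaningful.\<close>

lemma mv_hom_restrict:
  assumes "mv_algebra A" "f \<in> mv_hom A B"
  shows "restrict f (carrier A) \<in> mv_hom A B"
proof -
  interpret mv_algebra A by fact
  show ?thesis
    using assms(2) by (auto simp: mv_hom_def neg_closed)
qed

text \<open>Values on a finite generating set \<open>S\<close> determine a homomorphism, so
  restriction to \<open>S\<close> embeds the homomorphisms into the finite set
  \<open>S \<rightarrow>\<^sub>E carrier B\<close>.\<close>

lemma finite_mv_hom:
  assumes A: "mv_algebra A" and "mv_finitely_generated A" and "finite (carrier B)"
  shows "finite (mv_hom A B \<inter> extensional (carrier A))"
proof -
  from assms(2) obtain S
    where S: "finite S" "S \<subseteq> carrier A" "mv_generate A S = carrier A"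
    unfolding mv_finitely_generated_def by blast
  have "inj_on (\<lambda>f. restrict f S) (mv_hom A B \<inter> extensional (carrier A))"
  proof (rule inj_onI)
    fix f g
    assume f: "f \<in> mv_hom A B \<inter> extensional (carrier A)"
      and g: "g \<in> mv_hom A B \<inter> extensional (carrier A)"
      and eq: "restrict f S = restrict g S"
    have "f s = g s" if "s \<in> S" for s
      using that by (metis eq restrict_apply')
    then have "f x = g x" if "x \<in> carrier A" for x
      using mv_hom_eq_on_generate[OF A S(2), of f B g x] f g that S(3) by blast
    then show "f = g"
      using f g by (blast intro: extensionalityI)
  qed
  moreover have "(\<lambda>f. restrict f S) ` (mv_hom A B \<inter> extensional (carrier A)) \<subseteq> S \<rightarrow>\<^sub>E carrier B"
    using S(2) by (auto simp: mv_hom_def Pi_iff)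
  moreover have "finite (S \<rightarrow>\<^sub>E carrier B)"
    using S(1) assms(3) by (simp add: finite_PiE)
  ultimately show ?thesis
    using inj_on_finite by blast
qed

text \<open>Precomposition with \<open>h\<close> is injective because \<open>h\<close> is onto, and
  an injective self-map of a finite set is onto. So \<open>p\<close> has a preimage
  \<open>q\<close>.\<close>

lemma mv_hom_factors_through_surjective_endomorphism:
  assumes A: "mv_algebra A" and "mv_finitely_generated A" and "finite (carrier B)"
    and h: "h \<in> mv_hom A A" "h ` carrier A = carrier A"
    and p: "p \<in> mv_hom A B"
  obtains q where "q \<in> mv_hom A B" "\<And>x. x \<in> carrier A \<Longrightarrow> p x = q (h x)"
proof -
  let ?H = "mv_hom A B \<inter> extensional (carrier A)"
  \<comment> \<open>The composite need not be \<open>undefined\<close> off the carrier; restricting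
    it makes \<open>?F\<close> a self-map of \<open>?H\<close>.\<close>
  let ?F = "\<lambda>q. restrict (q \<circ> h) (carrier A)"
  have "inj_on ?F ?H"
  proof (rule inj_onI)
    fix q r assume q: "q \<in> ?H" and r: "r \<in> ?H" and eq: "?F q = ?F r"
    have "q (h x) = r (h x)" if "x \<in> carrier A" for x
      using fun_cong[OF eq, of x] that by simp
    then have "q y = r y" if "y \<in> carrier A" for y
      using that h(2) by (metis imageE)
    then show "q = r"
      using q r by (blast intro: extensionalityI)
  qed
  moreover have "?F ` ?H \<subseteq> ?H"
    using mv_hom_restrict[OF A mv_hom_compose[OF h(1)]] by auto
  ultimately have "?F ` ?H = ?H"
    using finite_mv_hom[OF assms(1-3)] by (simp add: endo_inj_surj)
  moreover have "restrict p (carrier A) \<in> ?H"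
    using mv_hom_restrict[OF A p] by simp
  ultimately obtain q where q: "q \<in> ?H" "restrict p (carrier A) = ?F q"
    by (metis (no_types, lifting) imageE)
  have "p x = q (h x)" if "x \<in> carrier A" for x
    using fun_cong[OF q(2), of x] that by simp
  with q(1) show thesis
    using that by blast
qed

text \<open>Residual finiteness is stated with all \<open>B\<close> over one type \<open>'c\<close>,
  as a hypothesis cannot quantify over types.\<close>

lemma mv_residually_finite_imp_hopfian:
  assumes A: "mv_algebra A" and "mv_finitely_generated A"
    and separate: "\<And>a. a \<in> carrier A \<Longrightarrow> a \<noteq> \<zero>\<^bsub>A\<^esub> \<Longrightarrow>
      \<exists>(B :: 'c mv_algebra) p. finite (carrier B) \<and> p \<in> mv_hom A B \<and> p a \<noteq> \<zero>\<^bsub>B\<^esub>"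
  shows "mv_hopfian A"
  unfolding mv_hopfian_def mv_automorphism_def
proof (intro ballI impI conjI)
  interpret mv_algebra A by fact
  fix h assume h: "h \<in> mv_hom A A" "h ` carrier A = carrier A"
  show "h \<in> mv_hom A A" by fact
  have kernel: "a = \<zero>\<^bsub>A\<^esub>" if a: "a \<in> carrier A" "h a = \<zero>\<^bsub>A\<^esub>" for a
  proof (rule ccontr)
    assume "a \<noteq> \<zero>\<^bsub>A\<^esub>"
    with separate a(1) obtain B :: "'c mv_algebra" and p
      where B: "finite (carrier B)" "p \<in> mv_hom A B" "p a \<noteq> \<zero>\<^bsub>B\<^esub>"
      by blast
    obtain q where "q \<in> mv_hom A B" "\<And>x. x \<in> carrier A \<Longrightarrow> p x = q (h x)"
      using mv_hom_factors_through_surjective_endomorphism[OF assms(1,2) B(1) h B(2)]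
      by blast
    then show False
      using a B(3) by (simp add: mv_hom_def)
  qed
  \<comment> \<open>The distance replaces the missing subtraction: it lies in the kernel when
    \<open>h x = h y\<close>, and it vanishes only if \<open>x = y\<close>.\<close>
  have "inj_on h (carrier A)"
  proof (rule inj_onI)
    fix x y assume xy: "x \<in> carrier A" "y \<in> carrier A" "h x = h y"
    then have "(x, y) \<in> mv_cong A (mv_kernel A A h)"
      using mv_cong_kernel_iff[OF A A h(1)] by blast
    then have "mv_diff A x y \<oplus>\<^bsub>A\<^esub> mv_diff A y x = \<zero>\<^bsub>A\<^esub>"
      using kernel by (auto simp: mv_cong_def mv_kernel_def)
    then show "x = y"
      using xy dist_zero_iff by blast
  qed
  with h(2) show "bij_betw h (carrier A) (carrier A)"
    by (simp add: bij_betw_def)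
qed

text \<open>An ideal is the kernel of some homomorphism; the canonical projection can take the place
  of that homomorphism.\<close>

lemma mv_ideal_quotient_hom:
  assumes "mv_algebra A" "mv_ideal A I"
  shows "(\<lambda>x. mv_cong A I `` {x}) \<in> mv_hom A (mv_quotient A I)"
    and "mv_kernel A (mv_quotient A I) (\<lambda>x. mv_cong A I `` {x}) = I"
  using assms mv_quotient_kernel(2,3)[OF assms(1)] unfolding mv_ideal_def by blast+

text \<open>The maximal ideals omitting \<open>a\<close> form a basic open set, nonempty by
  semisimplicity, and a dense set meets it.\<close>

lemma finite_rank_avoids_nonzero:
  assumes "mv_semisimple A"
    and dense: "mv_max_spec_topology A closure_of {M \<in> mv_max_spec A. mv_finite_rank A M}
         = topspace (mv_max_spec_topology A)"
    and a: "a \<in> carrier A" "a \<noteq> \<zero>\<^bsub>A\<^esub>"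
  obtains M where "M \<in> mv_max_spec A" "mv_finite_rank A M" "a \<notin> M"
proof -
  let ?U = "mv_max_spec A - {M \<in> mv_max_spec A. a \<in> M}"
  have "openin (mv_max_spec_topology A) ?U"
    unfolding mv_max_spec_topology_def using a(1) by (blast intro: topology_generated_by_Basis)
  moreover have "?U \<noteq> {}"
    using assms(1) a(2) unfolding mv_semisimple_def by blast
  ultimately have "?U \<inter> {M \<in> mv_max_spec A. mv_finite_rank A M} \<noteq> {}"
    using dense dense_intersects_open by blast
  then show thesis
    using that by blast
qed

theorem corollary2p2:
  fixes A :: "('a, 'b) mv_algebra_scheme"
  assumes "mv_algebra A"
    and "mv_finitely_generated A"
    and "mv_semisimple A"
    and "mv_max_spec_topology A closure_of {M \<in> mv_max_spec A. mv_finite_rank A M}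
         = topspace (mv_max_spec_topology A)"
  shows "mv_hopfian A"
proof (rule mv_residually_finite_imp_hopfian[OF assms(1,2)])
  fix a assume a: "a \<in> carrier A" "a \<noteq> \<zero>\<^bsub>A\<^esub>"
  obtain M where M: "M \<in> mv_max_spec A" "mv_finite_rank A M" "a \<notin> M"
    using finite_rank_avoids_nonzero[OF assms(3,4) a] .
  then have "mv_ideal A M"
    by (simp add: mv_max_spec_def mv_maximal_ideal_def)
  note quotient = mv_ideal_quotient_hom[OF assms(1) this]
  \<comment> \<open>The projection to the finite quotient separates \<open>a\<close> from zero,
    since its kernel is exactly \<open>M\<close>.\<close>
  have "mv_cong A M `` {a} \<noteq> \<zero>\<^bsub>mv_quotient A M\<^esub>"
    using quotient(2) a(1) M(3) unfolding mv_kernel_def by blast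
  with M(2) quotient(1)
  show "\<exists>(B :: 'a set mv_algebra) p. finite (carrier B) \<and> p \<in> mv_hom A B \<and> p a \<noteq> \<zero>\<^bsub>B\<^esub>"
    unfolding mv_finite_rank_def by blast
qed

end
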